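(* Let $(X,d_\eta)$ be a sequentially compact $\eta$-cone metric space such that $d_\eta$ is continuous, $\sup_{x,y\in X}\eta(x,y)<\infty$, and the underlying cone $P$ is regular. Suppose the map $T:X\to X$ satisfies the contractive condition $$d_\eta(Tx,Ty)\prec d_\eta(x,y)\quad\text{for all }x,y\in X,\ x\ne y.$$ Then $T$ has a unique fixed point in $X$.
   Context: Let $E$ be a real Banach space with norm $\|\cdot\|$ and zero vector $\theta$. A subset $P\subset E$ is a cone if: $P$ is closed, nonempty and $P\neq\{\theta\}$; $ax+by\in P$ for all $x,y\in P$ and all real $a,b\ge 0$; and $x\in P$, $-x\in P$ imply $x=\theta$. Write $x\preceq y$ iff $y-x\in P$; $x\prec y$ iff $x\preceq y$ and $x\ne y$; and $x\ll y$ iff $y-x\in \mathrm{Int}(P)$ (the interior of $P$). The cone $P$ is normal if there is a real $C>0$ such that $\theta\preceq x\preceq y$ implies $\|x\|\le C\|y\|$ for all $x,y\in E$; the least such positive number $K$ is the normal constant. The cone $P$ is regular if every sequence $(x_n)$ in $E$ with $x_1\preceq x_2\preceq\cdots\preceq x_n\preceq\cdots\preceq y$ for some $y\in E$ converges in norm to some $x^*\in E$. Standing assumption: $P$ is a normal cone with normal constant $K$ and $\mathrm{Int}(P)\ne\emptyset$. Let $X$ be a nonempty set and $\eta:X\times X\to[1,\infty)$ a map. A function $d_\eta:X\times X\to E$ is an $\eta$-cone metric on $X$, and $(X,d_\eta)$ an $\eta$-cone metric space, if for all $x,y,z\in X$: (d1) $\theta\preceq d_\eta(x,y)$, and $d_\eta(x,y)=\theta$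 iff $x=y$; (d2) $d_\eta(x,y)=d_\eta(y,x)$; (d3) $d_\eta(x,z)\preceq\eta(x,z)[d_\eta(x,y)+d_\eta(y,z)]$. A sequence $(x_n)$ in $X$ converges to $x\in X$ if for every $c\in E$ with $c\gg\theta$ there is $n_0\in\mathbb N$ with $d_\eta(x_n,x)\ll c$ for all $n\ge n_0$. $(X,d_\eta)$ is sequentially compact if every sequence in $X$ has a subsequence converging in $X$. The natural topology on $X$ is $\mathcal T_\eta=\{U\subset X:\forall x\in U,\ \exists c\gg\theta,\ B_\eta(x,c)\subset U\}$, where $B_\eta(x,c)=\{y\in X: d_\eta(x,y)\ll c\}$. "$d_\eta$ is continuous" means continuous as a map $X\times X\to E$, where $X\times X$ has the product of the natural topologies and $E$ the norm topology. *)

theory Defs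
  imports "HOL-Analysis.Analysis"
begin

section \<open>Cones in real Banach spaces\<close>

text \<open>Not to be confused with the constant \<open>cone\<close> of HOL-Analysis, which only asks for closure
  under multiplication by nonnegative scalars.\<close>

definition is_cone :: "'e::banach set \<Rightarrow> bool" where
  "is_cone P \<longleftrightarrow>
     closed P \<and> P \<noteq> {} \<and> P \<noteq> {0} \<and>
     (\<forall>x\<in>P. \<forall>y\<in>P. \<forall>a\<ge>0. \<forall>b\<ge>0. a *\<^sub>R x + b *\<^sub>R y \<in> P) \<and>
     (\<forall>x. x \<in> P \<and> - x \<in> P \<longrightarrow> x = 0)"

definition cone_le :: "'e::banach set \<Rightarrow> 'e \<Rightarrow> 'e \<Rightarrow> bool" where
  "cone_le P x y \<longleftrightarrow> y - x \<in> P"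

definition cone_less :: "'e::banach set \<Rightarrow> 'e \<Rightarrow> 'e \<Rightarrow> bool" where
  "cone_less P x y \<longleftrightarrow> cone_le P x y \<and> x \<noteq> y"

definition cone_ll :: "'e::banach set \<Rightarrow> 'e \<Rightarrow> 'e \<Rightarrow> bool" where
  "cone_ll P x y \<longleftrightarrow> y - x \<in> interior P"

definition normality_bound :: "'e::banach set \<Rightarrow> real \<Rightarrow> bool" where
  "normality_bound P C \<longleftrightarrow>
     C > 0 \<and> (\<forall>x y. cone_le P 0 x \<and> cone_le P x y \<longrightarrow> norm x \<le> C * norm y)"

definition normal_cone :: "'e::banach set \<Rightarrow> bool" where
  "normal_cone P \<longleftrightarrow> is_cone P \<and> (\<exists>C. normality_bound P C)"

definition is_normal_constant :: "'e::banach set \<Rightarrow> real \<Rightarrow> bool" where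
  "is_normal_constant P K \<longleftrightarrow>
     normality_bound P K \<and> (\<forall>C. normality_bound P C \<longrightarrow> K \<le> C)"

text \<open>The least bound is attained, so that speaking of \<^emph>\<open>the\<close> normal constant of a normal cone
  is not an extra hypothesis.\<close>

lemma normal_cone_imp_ex1_normal_constant:
  assumes "normal_cone P"
  shows "\<exists>!K. is_normal_constant P K"
proof -
  let ?S = "{C. normality_bound P C}"
  from assms obtain C0 where C0: "normality_bound P C0" and cone: "is_cone P"
    by (auto simp: normal_cone_def)
  from cone obtain p where p: "p \<in> P" "p \<noteq> 0"
    unfolding is_cone_def by blast
  have z: "0 \<in> P"
    using cone p(1) unfolding is_cone_def by (metis add_0 order_refl scaleR_zero_left)
  have ge1: "1 \<le> C" if "normality_bound P C" for C
  proof -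
    have "norm p \<le> C * norm p"
      using that p z unfolding normality_bound_def cone_le_def by simp
    then show ?thesis using p(2) by simp
  qed
  have bdd: "bdd_below ?S"
    by (rule bdd_belowI[of _ 1]) (simp add: ge1)
  have ne: "?S \<noteq> {}" using C0 by blast
  have pos: "1 \<le> Inf ?S"
    by (rule cInf_greatest[OF ne]) (simp add: ge1)
  have bound: "norm x \<le> Inf ?S * norm y" if le: "cone_le P 0 x" "cone_le P x y" for x y
  proof (cases "y = 0")
    case True
    have "norm x \<le> C0 * norm y" using C0 le unfolding normality_bound_def by blast
    then show ?thesis using True by simp
  next
    case False
    have "norm x / norm y \<le> C" if "C \<in> ?S" for C
    proof -
      have "norm x \<le> C * norm y" using that le unfolding normality_bound_def by blast
      then show ?thesis using False by (simp add: divide_le_eq)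
    qed
    then have "norm x / norm y \<le> Inf ?S" by (rule cInf_greatest[OF ne])
    then show ?thesis using False by (simp add: divide_le_eq)
  qed
  have "normality_bound P (Inf ?S)"
    using pos bound unfolding normality_bound_def by fastforce
  moreover have "Inf ?S \<le> C" if "normality_bound P C" for C
    by (rule cInf_lower[OF _ bdd]) (simp add: that)
  ultimately have inf: "is_normal_constant P (Inf ?S)"
    unfolding is_normal_constant_def by blast
  show ?thesis
  proof (rule ex1I[of "is_normal_constant P", OF inf])
    show "K = Inf ?S" if "is_normal_constant P K" for K
      using that inf unfolding is_normal_constant_def by (meson order_antisym)
  qed
qed

definition regular_cone :: "'e::banach set \<Rightarrow> bool" where
  "regular_cone P \<longleftrightarrow> is_cone P \<and>
     (\<forall>(x :: nat \<Rightarrow> 'e) y.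
        (\<forall>n. cone_le P (x n) (x (Suc n))) \<and> (\<forall>n. cone_le P (x n) y) \<longrightarrow> convergent x)"

section \<open>Cone metric spaces with variable coefficient\<close>

definition eta_cone_metric_space ::
    "'e::banach set \<Rightarrow> 'a set \<Rightarrow> ('a \<Rightarrow> 'a \<Rightarrow> real) \<Rightarrow> ('a \<Rightarrow> 'a \<Rightarrow> 'e) \<Rightarrow> bool" where
  "eta_cone_metric_space P X \<eta> d \<longleftrightarrow>
     X \<noteq> {} \<and>
     (\<forall>x\<in>X. \<forall>y\<in>X. 1 \<le> \<eta> x y) \<and>
     (\<forall>x\<in>X. \<forall>y\<in>X. cone_le P 0 (d x y) \<and> (d x y = 0 \<longleftrightarrow> x = y)) \<and>
     (\<forall>x\<in>X. \<forall>y\<in>X. d x y = d y x) \<and>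
     (\<forall>x\<in>X. \<forall>y\<in>X. \<forall>z\<in>X. cone_le P (d x z) (\<eta> x z *\<^sub>R (d x y + d y z)))"

definition cone_converges ::
    "'e::banach set \<Rightarrow> ('a \<Rightarrow> 'a \<Rightarrow> 'e) \<Rightarrow> (nat \<Rightarrow> 'a) \<Rightarrow> 'a \<Rightarrow> bool" where
  "cone_converges P d s x \<longleftrightarrow>
     (\<forall>c. cone_ll P 0 c \<longrightarrow> (\<exists>n0. \<forall>n\<ge>n0. cone_ll P (d (s n) x) c))"

definition cone_seq_compact :: "'e::banach set \<Rightarrow> 'a set \<Rightarrow> ('a \<Rightarrow> 'a \<Rightarrow> 'e) \<Rightarrow> bool" where
  "cone_seq_compact P X d \<longleftrightarrow>
     (\<forall>s :: nat \<Rightarrow> 'a. (\<forall>n. s n \<in> X) \<longrightarrow>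
        (\<exists>x\<in>X. \<exists>r. strict_mono r \<and> cone_converges P d (s \<circ> r) x))"

definition eta_ball :: "'e::banach set \<Rightarrow> 'a set \<Rightarrow> ('a \<Rightarrow> 'a \<Rightarrow> 'e) \<Rightarrow> 'a \<Rightarrow> 'e \<Rightarrow> 'a set" where
  "eta_ball P X d x c = {y \<in> X. cone_ll P (d x y) c}"

definition natural_open :: "'e::banach set \<Rightarrow> 'a set \<Rightarrow> ('a \<Rightarrow> 'a \<Rightarrow> 'e) \<Rightarrow> 'a set \<Rightarrow> bool" where
  "natural_open P X d U \<longleftrightarrow>
     U \<subseteq> X \<and> (\<forall>x\<in>U. \<exists>c. cone_ll P 0 c \<and> eta_ball P X d x c \<subseteq> U)"

definition natural_topology :: "'e::banach set \<Rightarrow> 'a set \<Rightarrow> ('a \<Rightarrow> 'a \<Rightarrow> 'e) \<Rightarrow> 'a topology" where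
  "natural_topology P X d = topology (natural_open P X d)"

text \<open>The type \<open>'a topology\<close> only carries the intended open sets because \<open>natural_open\<close> is a
  topology, and its underlying set is all of \<open>X\<close> because the cone has nonempty interior; see
  \<open>openin_natural_topology\<close> and \<open>topspace_natural_topology\<close> below.\<close>

lemma interior_cone_add:
  assumes "is_cone P" "a \<in> interior P" "b \<in> P"
  shows "a + b \<in> interior P"
proof (rule interiorI)
  show "open ((\<lambda>x. x + b) ` interior P)"
    using open_translation[OF open_interior[of P], of b] by (simp add: add.commute)
  show "a + b \<in> (\<lambda>x. x + b) ` interior P" using assms by simp
  have "x + b \<in> P" if "x \<in> P" for x
    using assms(1,3) that unfolding is_cone_def by (metis scaleR_one zero_le_one)
  then show "(\<lambda>x. x + b) ` interior P \<subseteq> P"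
    using interior_subset by auto
qed

lemma cone_ll_directed:
  assumes P: "is_cone P" and c1: "cone_ll P 0 c1" and c2: "cone_ll P 0 c2"
  obtains c where "cone_ll P 0 c" "cone_le P c c1" "cone_le P c c2"
proof -
  have i1: "c1 \<in> interior P" and i2: "c2 \<in> interior P"
    using c1 c2 by (simp_all add: cone_ll_def)
  have P1: "c1 \<in> P" using i1 interior_subset by blast
  have sc: "a *\<^sub>R x \<in> P" if "x \<in> P" "a \<ge> 0" for a x
    using P that unfolding is_cone_def by (metis add_0_right order_refl scaleR_zero_left)
  have "((\<lambda>t. c2 - t *\<^sub>R c1) \<longlongrightarrow> c2 - 0 *\<^sub>R c1) (at_right 0)"
    by (intro tendsto_intros)
  then have "\<forall>\<^sub>F t in at_right 0. c2 - t *\<^sub>R c1 \<in> interior P"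
    using i2 by (intro topological_tendstoD) auto
  moreover have "\<forall>\<^sub>F t in at_right (0::real). t \<in> {0<..<1}"
    by (rule eventually_at_right_real) simp
  ultimately have "\<forall>\<^sub>F t in at_right 0. c2 - t *\<^sub>R c1 \<in> interior P \<and> t \<in> {0<..<1}"
    by eventually_elim auto
  then obtain t where t: "c2 - t *\<^sub>R c1 \<in> interior P" "0 < t" "t < 1"
    using eventually_happens[of _ "at_right (0::real)"] by auto
  have "(\<lambda>x. t *\<^sub>R x) ` interior P \<subseteq> interior P"
    using t(2) sc interior_subset[of P] by (intro interior_maximal open_scaling) auto
  then have "cone_ll P 0 (t *\<^sub>R c1)"
    using i1 by (auto simp: cone_ll_def)
  moreover have "cone_le P (t *\<^sub>R c1) c1"
    using sc[OF P1, of "1 - t"] t by (simp add: cone_le_def scaleR_left_diff_distrib)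
  moreover have "cone_le P (t *\<^sub>R c1) c2"
    using t(1) interior_subset[of P] by (auto simp: cone_le_def)
  ultimately show ?thesis by (rule that)
qed

lemma eta_ball_mono:
  assumes "is_cone P" "cone_le P c c'"
  shows "eta_ball P X d x c \<subseteq> eta_ball P X d x c'"
proof -
  have "c' - d x y \<in> interior P" if "c - d x y \<in> interior P" for y
    using interior_cone_add[OF assms(1) that, of "c' - c"] assms(2) by (simp add: cone_le_def)
  then show ?thesis by (auto simp: eta_ball_def cone_ll_def)
qed

lemma istopology_natural_open:
  assumes P: "is_cone P"
  shows "istopology (natural_open P X d)"
  unfolding istopology_def
proof (intro conjI allI impI)
  fix S T assume S: "natural_open P X d S" and T: "natural_open P X d T"
  show "natural_open P X d (S \<inter> T)"
    unfolding natural_open_def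
  proof (intro conjI ballI)
    show "S \<inter> T \<subseteq> X" using S by (auto simp: natural_open_def)
  next
    fix x assume x: "x \<in> S \<inter> T"
    obtain c1 where c1: "cone_ll P 0 c1" "eta_ball P X d x c1 \<subseteq> S"
      using S x unfolding natural_open_def by blast
    obtain c2 where c2: "cone_ll P 0 c2" "eta_ball P X d x c2 \<subseteq> T"
      using T x unfolding natural_open_def by blast
    obtain c where c: "cone_ll P 0 c" "cone_le P c c1" "cone_le P c c2"
      using cone_ll_directed[OF P c1(1) c2(1)] .
    have "eta_ball P X d x c \<subseteq> S \<inter> T"
      using eta_ball_mono[OF P c(2), of X d x] eta_ball_mono[OF P c(3), of X d x] c1 c2 by blast
    with c(1) show "\<exists>c. cone_ll P 0 c \<and> eta_ball P X d x c \<subseteq> S \<inter> T" by blast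
  qed
next
  fix \<U> assume "\<forall>U\<in>\<U>. natural_open P X d U"
  then show "natural_open P X d (\<Union>\<U>)"
    unfolding natural_open_def by (meson Sup_least Union_iff Union_upper order_trans)
qed

lemma openin_natural_topology:
  assumes "is_cone P"
  shows "openin (natural_topology P X d) U \<longleftrightarrow>
    U \<subseteq> X \<and> (\<forall>x\<in>U. \<exists>c. cone_ll P 0 c \<and> eta_ball P X d x c \<subseteq> U)"
  using istopology_natural_open[OF assms, of X d]
  by (simp add: natural_topology_def topology_inverse' natural_open_def)

lemma topspace_natural_topology:
  assumes "is_cone P" "interior P \<noteq> {}"
  shows "topspace (natural_topology P X d) = X"
proof
  show "topspace (natural_topology P X d) \<subseteq> X"
    using iffD1[OF openin_natural_topology[OF assms(1)] openin_topspace] by (rule conjunct1)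
  have "openin (natural_topology P X d) X"
    unfolding openin_natural_topology[OF assms(1)]
  proof (intro conjI ballI subset_refl)
    fix x
    obtain c where "c \<in> interior P" using assms(2) by blast
    then have "cone_ll P 0 c" by (simp add: cone_ll_def)
    moreover have "eta_ball P X d x c \<subseteq> X" by (auto simp: eta_ball_def)
    ultimately show "\<exists>c. cone_ll P 0 c \<and> eta_ball P X d x c \<subseteq> X" by blast
  qed
  then show "X \<subseteq> topspace (natural_topology P X d)" by (rule openin_subset)
qed

definition eta_cone_metric_continuous ::
    "'e::banach set \<Rightarrow> 'a set \<Rightarrow> ('a \<Rightarrow> 'a \<Rightarrow> 'e) \<Rightarrow> bool" where
  "eta_cone_metric_continuous P X d \<longleftrightarrow>
     continuous_map (prod_topology (natural_topology P X d) (natural_topology P X d)) euclidean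
       (\<lambda>(x, y). d x y)"

end

theory Submission
  imports Defs
begin

text \<open>The argument follows Edelstein's fixed point theorem for compact metric spaces. The classical
  proof minimises the real function \<open>x \<mapsto> dist x (T x)\<close>; here the values \<open>d x (T x)\<close> lie in a cone
  that is only partially ordered, so a minimum need not exist. Instead, one follows a single orbit
  \<open>x\<^sub>n = T\<^sup>n x\<^sub>0\<close>. The displacements \<open>d x\<^sub>n x\<^sub>n\<^sub>+\<^sub>1\<close> decrease and are bounded below by zero, so regularity
  of the cone makes them converge in norm to some \<open>L\<close>.

  By compactness a subsequence of the orbit converges to a point \<open>z\<close>. Since \<open>T\<close> does not increase
  distances, the images of this subsequence under \<open>T\<close> and \<open>T\<^sup>2\<close> converge to \<open>T z\<close> and \<open>T\<^sup>2 z\<close>.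
  Continuity of \<open>d\<close> then identifies both \<open>d z (T z)\<close> and \<open>d (T z) (T\<^sup>2 z)\<close> as limits of subsequences
  of the displacements, so both equal \<open>L\<close>. If \<open>T z \<noteq> z\<close>, the contractive condition would make the
  second one strictly smaller than the first. Uniqueness is immediate from the same condition.\<close>

text \<open>Regularity speaks of increasing sequences; negation transfers it to decreasing ones.\<close>

lemma regular_cone_decreasing_convergent:
  assumes "regular_cone P"
    and dec: "\<And>n. cone_le P (u (Suc n)) (u n)" and lb: "\<And>n. cone_le P y (u n)"
  shows "convergent u"
proof -
  have "cone_le P (- u n) (- u (Suc n))" for n
    using dec[of n] by (simp add: cone_le_def)
  moreover have "cone_le P (- u n) (- y)" for n
    using lb[of n] by (simp add: cone_le_def)
  ultimately have "convergent (\<lambda>n. - u n)"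
    using assms(1)[unfolded regular_cone_def, THEN conjunct2, rule_format, of "\<lambda>n. - u n" "- y"]
    by simp
  then show ?thesis by (simp add: convergent_minus_iff[of u])
qed

lemma cone_le_ll_trans:
  assumes "is_cone P" "cone_le P a b" "cone_ll P b c"
  shows "cone_ll P a c"
  using interior_cone_add[OF assms(1), of "c - b" "b - a"] assms(2,3)
  by (simp add: cone_le_def cone_ll_def)

lemma cone_converges_dominated:
  assumes "is_cone P" "cone_converges P d s x"
    and "\<And>n. cone_le P (d' (t n) y) (d (s n) x)"
  shows "cone_converges P d' t y"
  using assms cone_le_ll_trans unfolding cone_converges_def by metis

text \<open>Order convergence is formulated without the topology, whereas continuity of \<open>d\<close> refers to the
  natural topology. Balls need not be open in that topology, but every open set contains a ball
  around each of its points, and this is the direction needed here.\<close>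

lemma cone_converges_imp_limitin:
  assumes P: "is_cone P" "interior P \<noteq> {}"
    and sym: "\<And>x y. x \<in> X \<Longrightarrow> y \<in> X \<Longrightarrow> d x y = d y x"
    and s: "\<And>n. s n \<in> X" and x: "x \<in> X" and conv: "cone_converges P d s x"
  shows "limitin (natural_topology P X d) s x sequentially"
  unfolding limitin_sequentially
proof (intro conjI allI impI)
  show "x \<in> topspace (natural_topology P X d)"
    using x by (simp add: topspace_natural_topology[OF P])
next
  fix U assume U: "openin (natural_topology P X d) U \<and> x \<in> U"
  then obtain c where c: "cone_ll P 0 c" "eta_ball P X d x c \<subseteq> U"
    unfolding openin_natural_topology[OF P(1)] by blast
  obtain N where N: "\<And>n. n \<ge> N \<Longrightarrow> cone_ll P (d (s n) x) c"
    using conv c(1) unfolding cone_converges_def by blast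
  have "s n \<in> U" if "n \<ge> N" for n
    using c(2) N[OF that] s[of n] sym[OF x s[of n]] by (auto simp: eta_ball_def)
  then show "\<exists>N. \<forall>n\<ge>N. s n \<in> U" by blast
qed

lemma eta_cone_metric_tendsto:
  assumes cont: "eta_cone_metric_continuous P X d"
    and s: "limitin (natural_topology P X d) s x sequentially"
    and t: "limitin (natural_topology P X d) t y sequentially"
  shows "(\<lambda>n. d (s n) (t n)) \<longlonglongrightarrow> d x y"
proof -
  have "limitin (prod_topology (natural_topology P X d) (natural_topology P X d))
          (\<lambda>n. (s n, t n)) (x, y) sequentially"
    using s t by (simp add: limitin_pairwise o_def)
  from continuous_map_limit[OF cont[unfolded eta_cone_metric_continuous_def] this]
  show ?thesis by (simp add: limitin_canonical_iff o_def)
qed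

theorem theorem4p5:
  fixes P :: "'e::banach set" and K :: real
    and X :: "'a set" and \<eta> :: "'a \<Rightarrow> 'a \<Rightarrow> real" and d :: "'a \<Rightarrow> 'a \<Rightarrow> 'e"
    and T :: "'a \<Rightarrow> 'a"
  assumes "normal_cone P" and "is_normal_constant P K" and "interior P \<noteq> {}"
    and "regular_cone P"
    and "eta_cone_metric_space P X \<eta> d"
    and "cone_seq_compact P X d"
    and "eta_cone_metric_continuous P X d"
    and "bdd_above ((\<lambda>(x, y). \<eta> x y) ` (X \<times> X))"
    and "T \<in> X \<rightarrow> X"
    and "\<forall>x\<in>X. \<forall>y\<in>X. x \<noteq> y \<longrightarrow> cone_less P (d (T x) (T y)) (d x y)"
  shows "\<exists>!x. x \<in> X \<and> T x = x"
proof -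
  have P: "is_cone P" using assms(1) by (simp add: normal_cone_def)
  have TX: "T x \<in> X" if "x \<in> X" for x using assms(9) that by blast
  have sym: "d x y = d y x" and pos: "cone_le P 0 (d x y)" and zero: "d x y = 0 \<longleftrightarrow> x = y"
    if "x \<in> X" "y \<in> X" for x y
    using assms(5) that unfolding eta_cone_metric_space_def by blast+
  have nonexp: "cone_le P (d (T x) (T y)) (d x y)" if "x \<in> X" "y \<in> X" for x y
  proof (cases "x = y")
    case True
    then have "d (T x) (T y) = 0" using zero TX that by metis
    then show ?thesis using pos[OF that] by simp
  next
    case False
    then show ?thesis using assms(10) that by (auto simp: cone_less_def)
  qed
  obtain x0 where x0: "x0 \<in> X"
    using assms(5) unfolding eta_cone_metric_space_def by fast
  define xs where "xs n = (T ^^ n) x0" for n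
  have xs_Suc: "xs (Suc n) = T (xs n)" for n by (simp add: xs_def)
  have xsX: "xs n \<in> X" for n by (induction n) (simp_all add: xs_def x0 TX)
  define u where "u n = d (xs n) (xs (Suc n))" for n
  have "convergent u"
  proof (rule regular_cone_decreasing_convergent[OF assms(4)])
    show "cone_le P (u (Suc n)) (u n)" for n
      using nonexp[OF xsX[of n] xsX[of "Suc n"]] by (simp add: u_def xs_Suc)
    show "cone_le P 0 (u n)" for n
      unfolding u_def by (intro pos xsX)
  qed
  then obtain L where L: "u \<longlonglongrightarrow> L" by (auto simp: convergent_def)
  obtain z r where z: "z \<in> X" and r: "strict_mono r" and conv: "cone_converges P d (xs \<circ> r) z"
    using assms(6) xsX unfolding cone_seq_compact_def by blast
  have conv1: "cone_converges P d (\<lambda>n. T (xs (r n))) (T z)"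
    by (rule cone_converges_dominated[OF P conv]) (simp add: nonexp xsX z)
  have conv2: "cone_converges P d (\<lambda>n. T (T (xs (r n)))) (T (T z))"
    by (rule cone_converges_dominated[OF P conv1]) (simp add: nonexp xsX z TX)
  note lim = cone_converges_imp_limitin[OF P assms(3) sym]
  have lim0: "limitin (natural_topology P X d) (\<lambda>n. xs (r n)) z sequentially"
    using lim[OF _ _ _ z conv] xsX by (simp add: o_def)
  have lim1: "limitin (natural_topology P X d) (\<lambda>n. T (xs (r n))) (T z) sequentially"
    using lim[OF _ _ _ TX[OF z] conv1] xsX TX by simp
  have lim2: "limitin (natural_topology P X d) (\<lambda>n. T (T (xs (r n)))) (T (T z)) sequentially"
    using lim[OF _ _ _ TX[OF TX[OF z]] conv2] xsX TX by simp
  have "(\<lambda>n. u (r n)) \<longlonglongrightarrow> d z (T z)"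
    using eta_cone_metric_tendsto[OF assms(7) lim0 lim1] by (simp add: u_def xs_Suc)
  moreover have "(\<lambda>n. u (r n)) \<longlonglongrightarrow> L"
    using LIMSEQ_subseq_LIMSEQ[OF L r] by (simp add: o_def)
  ultimately have d0: "d z (T z) = L" by (rule LIMSEQ_unique)
  have "(\<lambda>n. u (Suc (r n))) \<longlonglongrightarrow> d (T z) (T (T z))"
    using eta_cone_metric_tendsto[OF assms(7) lim1 lim2] by (simp add: u_def xs_Suc)
  moreover have "(\<lambda>n. u (Suc (r n))) \<longlonglongrightarrow> L"
    using LIMSEQ_subseq_LIMSEQ[OF LIMSEQ_Suc[OF L] r] by (simp add: o_def)
  ultimately have d1: "d (T z) (T (T z)) = L" by (rule LIMSEQ_unique)
  have fixed: "T z = z"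
    using assms(10) z TX[OF z] d0 d1 unfolding cone_less_def by metis
  show ?thesis
  proof (rule ex1I[of _ z])
    show "z \<in> X \<and> T z = z" using z fixed by blast
    show "y = z" if "y \<in> X \<and> T y = y" for y
      using assms(10) that z fixed unfolding cone_less_def by metis
  qed
qed

end
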